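(* Let $v=(a,b)$ be a cell of the $n\times n$ board (any board size $n$). (i) An enemy bishop on $v$ cannot be trapped by bishops if $v$ lies on a main diagonal (i.e. $a=b$ or $a+b=n+1$), or if $v$ lies on a diagonal adjacent to a main diagonal (i.e. $|a-b|=1$ or $|a+b-(n+1)|=1$) and $v$ is not on the border of the board. (ii) In all other cases, an enemy bishop on $v$ can be trapped, and the minimum number of bishops needed is $L-1$, where $L$ is the number of cells (including $v$) on the longer of the two diagonals (lines of slope $1$ and $-1$) through $v$.
   Context: Cells of the $n\times n$ board are $(x,y)$ with $1\le x,y\le n$; a cell is on the border if one of its coordinates is $1$ or $n$. A bishop attacks (can move to) every other cell on the board lying on a line of slope $1$ or $-1$ through its cell (other pieces do not block). A set $T$ of cells not containing $v$ (the positions of the soldier bishops) traps an enemy bishop on $v$ if: (1) no two distinct cells of $T\cup\{v\}$ attack each other; and (2) every cell attacked from $v$ is attacked from some cell of $T$. The number of bishops used is $|T|$.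
   Formalization: Part (i) is stated only for board sizes n other than 1: on the 1×1 board the bishop lies on a main diagonal but attacks no cell, so the empty set traps it and the claim fails there. *)

theory Defs
  imports Main
begin

type_synonym cell = "int \<times> int"

definition board :: "nat \<Rightarrow> cell set" where
  "board n = {1..int n} \<times> {1..int n}"

definition border :: "nat \<Rightarrow> cell set" where
  "border n = {(x, y) \<in> board n. x = 1 \<or> x = int n \<or> y = 1 \<or> y = int n}"

text \<open>The cells of the board on the line of slope \<open>s\<close> through a given cell
  (only used with \<open>s = 1\<close> and \<open>s = -1\<close>).\<close>

definition diagonal :: "nat \<Rightarrow> int \<Rightarrow> cell \<Rightarrow> cell set" where
  "diagonal n s p = {(x, y) \<in> board n. y - snd p = s * (x - fst p)}"

definition attacked :: "nat \<Rightarrow> cell \<Rightarrow> cell set" where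
  "attacked n p = (diagonal n 1 p \<union> diagonal n (-1) p) - {p}"

definition traps :: "nat \<Rightarrow> cell set \<Rightarrow> cell \<Rightarrow> bool" where
  "traps n T v \<longleftrightarrow>
     T \<subseteq> board n \<and> v \<notin> T \<and>
     (\<forall>p \<in> insert v T. \<forall>q \<in> insert v T. p \<noteq> q \<longrightarrow> q \<notin> attacked n p) \<and>
     (\<forall>c \<in> attacked n v. \<exists>t \<in> T. c \<in> attacked n t)"

definition trappable :: "nat \<Rightarrow> cell \<Rightarrow> bool" where
  "trappable n v \<longleftrightarrow> (\<exists>T. traps n T v)"

text \<open>Only meaningful when \<open>trappable n v\<close> holds.\<close>

definition min_bishops :: "nat \<Rightarrow> cell \<Rightarrow> nat" where
  "min_bishops n v = (LEAST k. \<exists>T. traps n T v \<and> card T = k)"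

definition on_main_diagonal :: "nat \<Rightarrow> cell \<Rightarrow> bool" where
  "on_main_diagonal n = (\<lambda>(a, b). a = b \<or> a + b = int n + 1)"

definition on_adjacent_diagonal :: "nat \<Rightarrow> cell \<Rightarrow> bool" where
  "on_adjacent_diagonal n = (\<lambda>(a, b). \<bar>a - b\<bar> = 1 \<or> \<bar>a + b - (int n + 1)\<bar> = 1)"

definition longer_diagonal_length :: "nat \<Rightarrow> cell \<Rightarrow> nat" where
  "longer_diagonal_length n v = max (card (diagonal n 1 v)) (card (diagonal n (-1) v))"

end

theory Submission
  imports Defs
begin

text \<open>
  Describe a cell by its two diagonals: \<open>rise\<close> numbers the lines of slope 1 and \<open>level n\<close> those of
  slope \<open>-1\<close>, both counted from the main diagonals. The board becomes
  \<open>\<bar>rise\<bar> + \<bar>level\<bar> \<le> n - 1\<close> with \<open>rise + level\<close> of the parity of \<open>n - 1\<close>. Let \<open>v\<close> have rise \<open>p\<close> and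
  level \<open>q\<close>; reflecting the board exchanges the two up to sign, so assume \<open>\<bar>p\<bar> \<le> \<bar>q\<bar>\<close>, and put
  \<open>M = n - 1 - \<bar>p\<bar>\<close>.

  A soldier stands on no diagonal through \<open>v\<close>, so it can attack a cell on one of these
  diagonals only along the other direction. Hence \<open>T\<close> traps \<open>v\<close> iff rises and levels are injective on
  \<open>T \<union> {v}\<close>, the levels of \<open>T\<close> include those of all other cells of rise \<open>p\<close>, and the rises of \<open>T\<close>
  include those of all other cells of level \<open>q\<close> (\<open>traps_iff\<close>). The levels to be covered are the
  \<open>M\<close> numbers \<open>\<noteq> q\<close> in \<open>-M, -M + 2, \<dots>, M\<close>, so at least \<open>M\<close> soldiers are needed, which is the
  lower bound.

  A soldier on an extreme level \<open>\<plusminus>M\<close> has \<open>\<bar>rise\<bar> \<le> \<bar>p\<bar>\<close> but not rise \<open>p\<close>. For \<open>p = 0\<close> no such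
  cell exists, although for \<open>n > 1\<close> at least one of these levels must be covered. For \<open>\<bar>p\<bar> = 1\<close> the rise must be \<open>-p\<close>, which only one soldier can have, so one of the two
  extreme levels must be that of \<open>v\<close>, and then \<open>v\<close> is on the border. This is part (i).

  Otherwise the \<open>M\<close> levels are matched with a suitable set of \<open>M\<close> rises that contains all the rises
  to be covered. The only constraint is \<open>\<bar>rise\<bar> + \<bar>level\<bar> \<le> n - 1\<close>, so the allowed rises for the various
  levels form a chain and a greedy matching succeeds as soon as the counting condition of Hall
  holds (\<open>threshold_matching\<close>); the count is done in \<open>matching_exists\<close>.
\<close>

section \<open>Diagonal coordinates\<close>

definition rise :: "cell \<Rightarrow> int" where
  "rise c = snd c - fst c"

definition level :: "nat \<Rightarrow> cell \<Rightarrow> int" where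
  "level n c = fst c + snd c - (int n + 1)"

definition cell_at :: "nat \<Rightarrow> int \<Rightarrow> int \<Rightarrow> cell" where
  "cell_at n d l = ((l + int n + 1 - d) div 2, (l + int n + 1 + d) div 2)"

lemma cell_eq_iff: "c = c' \<longleftrightarrow> rise c = rise c' \<and> level n c = level n c'"
  unfolding rise_def level_def prod_eq_iff by linarith

lemma board_iff: "c \<in> board n \<longleftrightarrow> \<bar>rise c\<bar> + \<bar>level n c\<bar> \<le> int n - 1"
  unfolding rise_def level_def board_def mem_Times_iff atLeastAtMost_iff
  by (auto simp: abs_if split: if_splits)

lemma border_iff: "c \<in> border n \<longleftrightarrow> \<bar>rise c\<bar> + \<bar>level n c\<bar> = int n - 1"
proof -
  have "c \<in> border n \<longleftrightarrow>
      c \<in> board n \<and> (fst c = 1 \<or> fst c = int n \<or> snd c = 1 \<or> snd c = int n)"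
    by (cases c) (auto simp: border_def)
  then show ?thesis
    unfolding rise_def level_def board_def mem_Times_iff atLeastAtMost_iff
    by (auto simp: abs_if split: if_splits)
qed

lemma parity_rise_level: "even (rise c + level n c + int n + 1)"
  unfolding rise_def level_def by simp

lemma
  assumes "even (d + l + int n + 1)"
  shows rise_cell_at: "rise (cell_at n d l) = d"
    and level_cell_at: "level n (cell_at n d l) = l"
  using assms unfolding rise_def level_def cell_at_def fst_conv snd_conv by presburger+

lemma diagonal_1: "diagonal n 1 v = {c \<in> board n. rise c = rise v}"
  by (auto simp: diagonal_def rise_def)

lemma diagonal_m1: "diagonal n (-1) v = {c \<in> board n. level n c = level n v}"
  by (auto simp: diagonal_def level_def)

lemma attacked_iff:
  "c \<in> attacked n t \<longleftrightarrow> c \<in> board n \<and> c \<noteq> t \<and> (rise c = rise t \<or> level n c = level n t)"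
  unfolding attacked_def diagonal_1 diagonal_m1 by auto

lemma traps_iff:
  assumes v: "v \<in> board n"
  shows "traps n T v \<longleftrightarrow> T \<subseteq> board n \<and> v \<notin> T \<and>
    inj_on rise (insert v T) \<and> inj_on (level n) (insert v T) \<and>
    (\<forall>c \<in> board n. c \<noteq> v \<and> rise c = rise v \<longrightarrow> level n c \<in> level n ` T) \<and>
    (\<forall>c \<in> board n. c \<noteq> v \<and> level n c = level n v \<longrightarrow> rise c \<in> rise ` T)"
    (is "_ \<longleftrightarrow> ?R")
proof
  assume tr: "traps n T v"
  then have T: "T \<subseteq> board n" "v \<notin> T"
    and free: "\<And>p q. p \<in> insert v T \<Longrightarrow> q \<in> insert v T \<Longrightarrow> p \<noteq> q \<Longrightarrow> q \<notin> attacked n p"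
    and cover: "\<And>c. c \<in> attacked n v \<Longrightarrow> \<exists>t\<in>T. c \<in> attacked n t"
    by (auto simp: traps_def)
  have inj: "inj_on rise (insert v T)" "inj_on (level n) (insert v T)"
    unfolding inj_on_def using free T(1) v attacked_iff by (metis insert_iff subsetD)+
  have "level n c \<in> level n ` T" if c: "c \<in> board n" "c \<noteq> v" "rise c = rise v" for c
  proof -
    obtain t where "t \<in> T" "c \<in> attacked n t"
      using cover[of c] c by (auto simp: attacked_iff[of c n v])
    moreover have "rise t \<noteq> rise v"
      using inj_onD[OF inj(1)] \<open>t \<in> T\<close> T(2) by blast
    ultimately show ?thesis
      using c by (auto simp: attacked_iff)
  qed
  moreover have "rise c \<in> rise ` T" if c: "c \<in> board n" "c \<noteq> v" "level n c = level n v" for c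
  proof -
    obtain t where "t \<in> T" "c \<in> attacked n t"
      using cover[of c] c by (auto simp: attacked_iff[of c n v])
    moreover have "level n t \<noteq> level n v"
      using inj_onD[OF inj(2)] \<open>t \<in> T\<close> T(2) by blast
    ultimately show ?thesis
      using c by (auto simp: attacked_iff)
  qed
  ultimately show ?R
    using T inj by blast
next
  assume R: ?R
  have "\<exists>t\<in>T. c \<in> attacked n t" if c: "c \<in> attacked n v" for c
  proof -
    have "c \<notin> T"
      using c R inj_onD[of rise "insert v T" c v] inj_onD[of "level n" "insert v T" c v]
      by (auto simp: attacked_iff)
    with c R show ?thesis
      unfolding attacked_iff image_iff by metis
  qed
  then show "traps n T v"
    unfolding traps_def using R by (auto simp: attacked_iff inj_on_def)
qed

section \<open>Counting integers of a given parity\<close>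

text \<open>The interval has an even number of elements, half of them of each parity, so that its
  cardinality does not depend on the parity of \<open>r\<close>. If \<open>M\<close> and \<open>r\<close> have equal parity then this is
  the symmetric progression \<open>-M, -M + 2, \<dots>, M\<close>; that is always so for the levels of the cells
  of a given rise. For the rises of the soldiers both parities of \<open>r\<close> occur: they must
  be exactly as many as the levels, so if \<open>M\<close> and \<open>r\<close> differ in parity they run from \<open>-M + 1\<close> to
  \<open>M + 1\<close> instead.\<close>

definition progression :: "int \<Rightarrow> int \<Rightarrow> int set" where
  "progression M r = {x. -M \<le> x \<and> x \<le> M + 1 \<and> even (x - r)}"

lemma finite_progression [simp]: "finite (progression M r)"
  by (rule finite_subset[of _ "{-M..M+1}"]) (auto simp: progression_def)

lemma card_parity_interval: "card {x::int. l \<le> x \<and> x < l + 2 * int m \<and> even (x - r)} = m"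
proof (induction m)
  case (Suc m)
  define y where "y = (if even (l - r) then l + 2 * int m else l + 2 * int m + 1)"
  let ?A = "{x. l \<le> x \<and> x < l + 2 * int m \<and> even (x - r)}"
  have "{x. l \<le> x \<and> x < l + 2 * int (Suc m) \<and> even (x - r)} = insert y ?A"
  proof (rule set_eqI)
    fix x
    show "x \<in> {x. l \<le> x \<and> x < l + 2 * int (Suc m) \<and> even (x - r)} \<longleftrightarrow> x \<in> insert y ?A"
      unfolding y_def insert_iff mem_Collect_eq of_nat_Suc by (cases "even (l - r)"; simp; presburger)
  qed
  moreover have "y \<notin> ?A"
    by (auto simp: y_def split: if_splits)
  moreover have "finite ?A"
    by (rule finite_subset[of _ "{l..<l + 2 * int m}"]) auto
  ultimately show ?case
    using Suc by simp
next
  case 0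
  have "{x. l \<le> x \<and> x < l + 2 * int 0 \<and> even (x - r)} = {}"
    by auto
  then show ?case
    by (metis card.empty)
qed

lemma card_progression: "M \<ge> -1 \<Longrightarrow> int (card (progression M r)) = M + 1"
proof -
  assume M: "M \<ge> -1"
  then have "progression M r = {x. -M \<le> x \<and> x < -M + 2 * int (nat (M + 1)) \<and> even (x - r)}"
    by (auto simp: progression_def)
  with M show ?thesis
    using card_parity_interval[of "-M" "nat (M + 1)" r] by simp
qed

lemma progression_symmetric:
  "even (M - r) \<Longrightarrow> x \<in> progression M r \<longleftrightarrow> \<bar>x\<bar> \<le> M \<and> even (x - r)"
  unfolding progression_def mem_Collect_eq by presburger

lemma card_diagonal_1:
  assumes v: "v \<in> board n"
  shows "int (card (diagonal n 1 v)) = int n - \<bar>rise v\<bar>"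
proof -
  let ?P = "progression (int n - 1 - \<bar>rise v\<bar>) (level n v)"
  have par: "even (int n - 1 - \<bar>rise v\<bar> - level n v)"
    using parity_rise_level[of v n] by presburger
  have "level n ` diagonal n 1 v = ?P"
  proof (rule set_eqI, rule iffI)
    fix l assume "l \<in> level n ` diagonal n 1 v"
    then obtain c where c: "c \<in> board n" "rise c = rise v" "l = level n c"
      by (auto simp: diagonal_1)
    have "even (l - level n v)"
      using parity_rise_level[of v n] parity_rise_level[of c n] c(2,3) by presburger
    with c show "l \<in> ?P"
      by (simp add: progression_symmetric[OF par] board_iff)
  next
    fix l assume l: "l \<in> ?P"
    then have "even (rise v + l + int n + 1)"
      using parity_rise_level[of v n] by (simp add: progression_symmetric[OF par])
    note at = rise_cell_at[OF this] level_cell_at[OF this]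
    have "cell_at n (rise v) l \<in> diagonal n 1 v"
      using l unfolding progression_symmetric[OF par] by (simp add: diagonal_1 board_iff at)
    then show "l \<in> level n ` diagonal n 1 v"
      using at by (metis image_eqI)
  qed
  moreover have "inj_on (level n) (diagonal n 1 v)"
    by (auto simp: inj_on_def diagonal_1 cell_eq_iff[where n = n])
  ultimately have "card (diagonal n 1 v) = card ?P"
    using card_image by metis
  then show ?thesis
    using v by (simp add: card_progression board_iff)
qed

section \<open>Reflection of the board\<close>

definition flip :: "nat \<Rightarrow> cell \<Rightarrow> cell" where
  "flip n c = (fst c, int n + 1 - snd c)"

lemma flip_flip [simp]: "flip n (flip n c) = c"
  by (simp add: flip_def)

lemma rise_flip [simp]: "rise (flip n c) = - level n c"
  by (simp add: flip_def rise_def level_def)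

lemma level_flip [simp]: "level n (flip n c) = - rise c"
  by (simp add: flip_def rise_def level_def)

lemma board_flip [simp]: "flip n c \<in> board n \<longleftrightarrow> c \<in> board n"
  by (simp add: board_iff add.commute)

lemma border_flip [simp]: "flip n c \<in> border n \<longleftrightarrow> c \<in> border n"
  by (simp add: border_iff add.commute)

lemma inj_flip: "inj_on (flip n) A"
  by (metis flip_flip inj_onI)

lemma attacked_flip: "c \<in> attacked n (flip n t) \<longleftrightarrow> flip n c \<in> attacked n t"
  unfolding attacked_iff board_flip rise_flip level_flip
  by (metis add.inverse_inverse flip_flip)

lemma traps_flip:
  assumes "traps n T v"
  shows "traps n (flip n ` T) (flip n v)"
  unfolding traps_def
proof (intro conjI ballI impI)
  show "flip n ` T \<subseteq> board n" "flip n v \<notin> flip n ` T"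
    using assms by (auto simp: traps_def) (metis flip_flip)
next
  fix p q assume "p \<in> insert (flip n v) (flip n ` T)" "q \<in> insert (flip n v) (flip n ` T)" "p \<noteq> q"
  then obtain p' q' where "p = flip n p'" "q = flip n q'"
      "p' \<in> insert v T" "q' \<in> insert v T" "p' \<noteq> q'"
    by blast
  then show "q \<notin> attacked n p"
    using assms unfolding traps_def by (auto simp: attacked_flip)
next
  fix c assume "c \<in> attacked n (flip n v)"
  then obtain t where "t \<in> T" "flip n c \<in> attacked n t"
    using assms by (auto simp: attacked_flip traps_def)
  then show "\<exists>t\<in>flip n ` T. c \<in> attacked n t"
    by (auto simp: attacked_flip)
qed

lemma traps_card_flip: "(\<exists>T. traps n T (flip n v) \<and> card T = k) \<longleftrightarrow> (\<exists>T. traps n T v \<and> card T = k)"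
proof -
  have "\<exists>T. traps n T (flip n w) \<and> card T = k" if "traps n T w" "card T = k" for w T
    using traps_flip[OF that(1)] card_image[OF inj_flip, of n T] that(2) by auto
  then show ?thesis
    by (metis flip_flip)
qed

lemma trappable_flip: "trappable n (flip n v) \<longleftrightarrow> trappable n v"
  unfolding trappable_def using traps_card_flip by blast

lemma min_bishops_flip: "min_bishops n (flip n v) = min_bishops n v"
  unfolding min_bishops_def traps_card_flip ..

lemma on_main_diagonal_iff: "on_main_diagonal n v \<longleftrightarrow> rise v = 0 \<or> level n v = 0"
  by (cases v) (auto simp: on_main_diagonal_def rise_def level_def)

lemma on_adjacent_diagonal_iff: "on_adjacent_diagonal n v \<longleftrightarrow> \<bar>rise v\<bar> = 1 \<or> \<bar>level n v\<bar> = 1"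
  by (cases v) (auto simp: on_adjacent_diagonal_def rise_def level_def)

lemma card_diagonal_m1:
  assumes "v \<in> board n"
  shows "int (card (diagonal n (-1) v)) = int n - \<bar>level n v\<bar>"
proof -
  have "diagonal n (-1) v = flip n ` diagonal n 1 (flip n v)"
  proof (rule set_eqI)
    fix c
    have "c \<in> flip n ` A \<longleftrightarrow> flip n c \<in> A" for A
      by (metis flip_flip image_iff)
    then show "c \<in> diagonal n (-1) v \<longleftrightarrow> c \<in> flip n ` diagonal n 1 (flip n v)"
      by (simp add: diagonal_1 diagonal_m1)
  qed
  then have "card (diagonal n (-1) v) = card (diagonal n 1 (flip n v))"
    by (simp add: card_image inj_flip)
  then show ?thesis
    using card_diagonal_1[of "flip n v" n] assms by simp
qed

lemma longer_diagonal_length_eq: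
  assumes "v \<in> board n"
  shows "int (longer_diagonal_length n v) = int n - min \<bar>rise v\<bar> \<bar>level n v\<bar>"
  using card_diagonal_1[OF assms] card_diagonal_m1[OF assms]
  by (auto simp: longer_diagonal_length_def max_def min_def)

section \<open>Matching the levels with the rises\<close>

text \<open>The partners allowed for \<open>a\<close> shrink as \<open>f a\<close> grows, so matching the largest \<open>f a\<close> with the
  smallest \<open>g b\<close> wastes nothing: both sides of each remaining counting condition drop by one.\<close>

lemma threshold_matching:
  fixes f :: "'a \<Rightarrow> 'c :: linordered_ab_group_add" and g :: "'b \<Rightarrow> 'c"
  assumes "finite A" "finite B" "card A = card B"
    and "\<And>a. a \<in> A \<Longrightarrow> card {a' \<in> A. f a \<le> f a'} \<le> card {b \<in> B. f a + g b \<le> N}"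
  shows "\<exists>m. bij_betw m A B \<and> (\<forall>a\<in>A. f a + g (m a) \<le> N)"
  using assms
proof (induction "card A" arbitrary: A B)
  case 0
  then show ?case
    by (auto simp: bij_betw_def)
next
  case (Suc k)
  then have ne: "A \<noteq> {}" "B \<noteq> {}"
    by auto
  obtain a where a: "a \<in> A" "\<And>x. x \<in> A \<Longrightarrow> f x \<le> f a"
  proof -
    have "Max (f ` A) \<in> f ` A"
      using Suc.prems(1) ne(1) by simp
    then obtain a where "a \<in> A" "f a = Max (f ` A)"
      by auto
    with that show thesis
      using Suc.prems(1) by simp
  qed
  obtain b where b: "b \<in> B" "\<And>x. x \<in> B \<Longrightarrow> g b \<le> g x"
  proof -
    have "Min (g ` B) \<in> g ` B"
      using Suc.prems(2) ne(2) by simp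
    then obtain b where "b \<in> B" "g b = Min (g ` B)"
      by auto
    with that show thesis
      using Suc.prems(2) by simp
  qed
  have "card {x \<in> A. f a \<le> f x} > 0"
    using a(1) Suc.prems(1) by (auto simp: card_gt_0_iff)
  then have "card {x \<in> B. f a + g x \<le> N} > 0"
    using Suc.prems(4)[OF a(1)] by linarith
  then obtain b' where "b' \<in> B" "f a + g b' \<le> N"
    by (auto simp: card_gt_0_iff)
  then have ab: "f a + g b \<le> N"
    using b(2)[of b'] by (meson add_left_mono order_trans)
  have "\<exists>m. bij_betw m (A - {a}) (B - {b}) \<and> (\<forall>x\<in>A - {a}. f x + g (m x) \<le> N)"
  proof (rule Suc.hyps(1))
    fix x assume x: "x \<in> A - {a}"
    let ?A = "{x' \<in> A. f x \<le> f x'}" and ?B = "{y \<in> B. f x + g y \<le> N}"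
    have "{x' \<in> A - {a}. f x \<le> f x'} = ?A - {a}" "{y \<in> B - {b}. f x + g y \<le> N} = ?B - {b}"
      by auto
    moreover have "card (?A - {a}) = card ?A - 1"
      using a x Suc.prems(1) by simp
    moreover have "card (?B - {b}) \<ge> card ?B - 1"
      using diff_card_le_card_Diff[of "{b}" ?B] by simp
    moreover have "card ?A \<le> card ?B"
      using Suc.prems(4) x by blast
    ultimately show "card {x' \<in> A - {a}. f x \<le> f x'} \<le> card {y \<in> B - {b}. f x + g y \<le> N}"
      by simp
  qed (use Suc.hyps(2) Suc.prems a(1) b(1) in simp_all)
  then obtain m where m: "bij_betw m (A - {a}) (B - {b})" "\<forall>x\<in>A - {a}. f x + g (m x) \<le> N"
    by blast
  have "bij_betw (m(a := b)) (A - {a}) (B - {b})"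
    using m(1) by (rule bij_betw_cong[THEN iffD1, rotated]) auto
  then have "bij_betw (m(a := b)) (insert a (A - {a})) (insert b (B - {b}))"
    using notIn_Un_bij_betw[of a "A - {a}" "m(a := b)" "B - {b}"] by simp
  then have "bij_betw (m(a := b)) A B"
    using a(1) b(1) by (simp add: insert_absorb)
  moreover have "\<forall>x\<in>A. f x + g ((m(a := b)) x) \<le> N"
    using m(2) ab by auto
  ultimately show ?case
    by blast
qed

text \<open>For a level \<open>s\<close> of modulus \<open>t\<close> there are at most \<open>M + 2 - t\<close> levels of modulus \<open>\<ge> t\<close>, and
  one less if \<open>\<bar>q\<bar> \<ge> t\<close>. Level \<open>s\<close> itself has \<open>N - t = M + \<bar>p\<bar> - t\<close> rises at its disposal, or all
  \<open>M\<close> of them if \<open>N - t\<close> exceeds \<open>M\<close>. So the counting condition holds if \<open>\<bar>p\<bar> \<ge> 2\<close>, and also if \<open>\<bar>p\<bar> = 1\<close> and \<open>\<bar>q\<bar> = M\<close>.\<close>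

lemma matching_exists:
  fixes p q N M :: int
  assumes pq: "0 < \<bar>p\<bar>" "\<bar>p\<bar> \<le> \<bar>q\<bar>" "\<bar>p\<bar> + \<bar>q\<bar> \<le> N" and par: "even (p + q + N)"
    and border: "\<bar>p\<bar> = 1 \<Longrightarrow> \<bar>p\<bar> + \<bar>q\<bar> = N"
    and M: "M = N - \<bar>p\<bar>"
  shows "\<exists>m. bij_betw m (progression M q - {q}) (progression M p - {p}) \<and>
    (\<forall>s \<in> progression M q - {q}. \<bar>s\<bar> + \<bar>m s\<bar> \<le> N)"
proof (rule threshold_matching)
  have qP: "q \<in> progression M q" and pP: "p \<in> progression M p"
    using pq unfolding M progression_def by auto
  have M0: "M \<ge> 0"
    using pq M by linarith
  have cS: "int (card (progression M q - {q})) = M" and cE: "int (card (progression M p - {p})) = M"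
    using card_progression[of M q] card_progression[of M p] M0 card.remove[OF finite_progression qP]
      card.remove[OF finite_progression pP] by simp_all
  then show "card (progression M q - {q}) = card (progression M p - {p})"
    by linarith
  have parM: "even (M - q)"
    using par unfolding M by presburger
  fix s assume s: "s \<in> progression M q - {q}"
  define t where "t = \<bar>s\<bar>"
  have t: "0 \<le> t" "t \<le> M" "even (t - q)"
    using s unfolding t_def Diff_iff progression_symmetric[OF parM] by (auto simp: abs_if)
  let ?S = "{s' \<in> progression M q - {q}. \<bar>s\<bar> \<le> \<bar>s'\<bar>}"
  let ?E = "{e \<in> progression M p - {p}. \<bar>s\<bar> + \<bar>e\<bar> \<le> N}"
  show "card ?S \<le> card ?E"
  proof (cases "M + 1 \<le> N - t")
    case True
    then have "?E = progression M p - {p}"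
      unfolding progression_def t_def by auto
    moreover have "card ?S \<le> card (progression M q - {q})"
      by (rule card_mono) auto
    ultimately show ?thesis
      using cS cE by simp
  next
    case False
    then have t1: "t \<ge> 1"
      using pq M by linarith
    have "even (N - t - p)"
      using t(3) par by presburger
    note symE = progression_symmetric[OF this]
    have "p \<in> progression (N - t) p"
      unfolding symE using t M by simp
    moreover have "int (card (progression (N - t) p)) = N - t + 1"
      using t M by (intro card_progression) linarith
    ultimately have "int (card (progression (N - t) p - {p})) = N - t"
      using card.remove[OF finite_progression, of p "N - t" p] by linarith
    moreover have "?E = progression (N - t) p - {p}"
    proof (rule set_eqI)
      fix e
      have "e \<in> progression M p \<and> t + \<bar>e\<bar> \<le> N \<longleftrightarrow> e \<in> progression (N - t) p"
        unfolding symE using False by (auto simp: progression_def)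
      then show "e \<in> ?E \<longleftrightarrow> e \<in> progression (N - t) p - {p}"
        by (auto simp: t_def)
    qed
    ultimately have E: "int (card ?E) = N - t"
      by simp
    have "even (t - 2 - q)"
      using t(3) by presburger
    note symt = progression_symmetric[OF this]
    let ?Q = "progression M q - progression (t - 2) q"
    have "progression (t - 2) q \<subseteq> progression M q"
      using t unfolding progression_def by auto
    then have "int (card ?Q) = (M + 1) - (t - 1)"
      using t1 M0 card_progression[of M q] card_progression[of "t - 2" q]
        card_mono[of "progression M q" "progression (t - 2) q"]
      by (simp add: card_Diff_subset of_nat_diff)
    moreover have "card ?S \<le> card (?Q - {q})"
      by (rule card_mono) (auto simp: symt simp flip: t_def)
    ultimately have S: "int (card (?Q - {q})) \<ge> int (card ?S)" "int (card ?Q) = M + 2 - t"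
      by auto
    show ?thesis
    proof (cases "\<bar>p\<bar> = 1")
      case True
      then have "q \<in> ?Q"
        using border t M qP by (auto simp: symt)
      then have "card ?Q = Suc (card (?Q - {q}))"
        by (intro card.remove) auto
      with S E True M show ?thesis
        by linarith
    next
      case False
      have "card (?Q - {q}) \<le> card ?Q"
        by (rule card_mono) auto
      with S E False pq M show ?thesis
        by linarith
    qed
  qed
qed auto

section \<open>Trapped bishops\<close>

lemma required_levels:
  assumes v: "v \<in> board n" and T: "traps n T v"
  shows "progression (int n - 1 - \<bar>rise v\<bar>) (level n v) - {level n v} \<subseteq> level n ` T"
proof
  let ?M = "int n - 1 - \<bar>rise v\<bar>"
  have par: "even (?M - level n v)"
    using parity_rise_level[of v n] by presburger
  fix l assume l: "l \<in> progression ?M (level n v) - {level n v}"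
  then have "even (rise v + l + int n + 1)"
    using parity_rise_level[of v n] by (simp add: progression_symmetric[OF par])
  note at = rise_cell_at[OF this] level_cell_at[OF this]
  have "cell_at n (rise v) l \<in> board n"
    using l unfolding Diff_iff progression_symmetric[OF par] by (simp add: board_iff at)
  moreover have "cell_at n (rise v) l \<noteq> v"
    using l at(2) by auto
  ultimately show "l \<in> level n ` T"
    using T at unfolding traps_iff[OF v] by metis
qed

lemma lower_bound:
  assumes v: "v \<in> board n" and T: "traps n T v"
  shows "int n - 1 - \<bar>rise v\<bar> \<le> int (card T)"
proof -
  let ?P = "progression (int n - 1 - \<bar>rise v\<bar>) (level n v)"
  have "finite (board n)"
    by (simp add: board_def)
  then have "finite T"
    using T by (auto simp: traps_def intro: finite_subset)
  then have "card (?P - {level n v}) \<le> card T"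
    using required_levels[OF v T] surj_card_le by blast
  moreover have "card ?P - 1 \<le> card (?P - {level n v})"
    using diff_card_le_card_Diff[of "{level n v}" ?P] by simp
  moreover have "int (card ?P) = int n - \<bar>rise v\<bar>"
    using v by (simp add: card_progression board_iff)
  ultimately show ?thesis
    by linarith
qed

lemma not_trappable:
  assumes v: "v \<in> board n" and "n \<noteq> 1"
    and bad: "rise v = 0 \<or> \<bar>rise v\<bar> = 1 \<and> v \<notin> border n \<and> level n v \<noteq> 0"
  shows "\<not> trappable n v"
proof
  assume "trappable n v"
  then obtain T where T: "traps n T v"
    by (auto simp: trappable_def)
  define M where "M = int n - 1 - \<bar>rise v\<bar>"
  have par: "even (M - level n v)"
    using parity_rise_level[of v n] unfolding M_def by presburger
  have M: "\<bar>level n v\<bar> \<le> M"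
    using v by (simp add: board_iff M_def)
  have opposite: "d = - p \<and> p \<noteq> 0"
    if "even (d - p)" "d \<noteq> p" "\<bar>d\<bar> \<le> \<bar>p\<bar>" "\<bar>p\<bar> \<le> 1" for d p :: int
  proof -
    have "p = 0 \<or> p = 1 \<or> p = -1" "d = 0 \<or> d = 1 \<or> d = -1"
      using that by linarith+
    with that show ?thesis
      by auto
  qed
  have soldier: "\<exists>t\<in>T. level n t = l \<and> rise t = - rise v \<and> rise v \<noteq> 0"
    if l: "\<bar>l\<bar> = M" "l \<noteq> level n v" for l
  proof -
    have "l \<in> progression M (level n v)"
      using l par unfolding progression_symmetric[OF par] by (auto simp: abs_if split: if_splits)
    then obtain t where t: "t \<in> T" "level n t = l"
      using required_levels[OF v T] l unfolding M_def by blast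
    moreover have "rise t \<noteq> rise v"
      using T t(1) inj_onD[of rise "insert v T" t v] unfolding traps_iff[OF v] by blast
    moreover have "\<bar>rise t\<bar> \<le> \<bar>rise v\<bar>"
      using T t l unfolding traps_iff[OF v] M_def by (auto simp: board_iff)
    moreover have "even (rise t - rise v)"
    proof -
      have "even (l - level n v)"
        using par l by presburger
      then show ?thesis
        using parity_rise_level[of v n] parity_rise_level[of t n] t(2) by presburger
    qed
    ultimately show ?thesis
      using bad opposite[of "rise t" "rise v"] by auto
  qed
  show False
  proof (cases "rise v = 0")
    case True
    have "M > 0"
      using True v \<open>n \<noteq> 1\<close> by (simp add: board_iff M_def)
    then have "M \<noteq> level n v \<or> - M \<noteq> level n v"
      by linarith
    with soldier[of M] soldier[of "-M"] True \<open>M > 0\<close> show False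
      by (metis abs_minus_cancel abs_of_pos)
  next
    case False
    have ne: "M \<noteq> level n v" "- M \<noteq> level n v" "M > 0"
      using False bad M by (auto simp: border_iff M_def)
    then obtain t u where "t \<in> T" "level n t = M" "rise t = - rise v"
      "u \<in> T" "level n u = - M" "rise u = - rise v"
      using soldier[of M] soldier[of "-M"] by auto
    moreover have "inj_on rise T"
      using T unfolding traps_iff[OF v] by (auto intro: inj_on_subset)
    ultimately show False
      using ne(3) by (metis inj_onD less_irrefl neg_less_0_iff_less order_less_trans)
  qed
qed

text \<open>The rises that have to be covered have modulus at most \<open>n - 1 - \<bar>level n v\<bar>\<close>. As
  \<open>\<bar>rise v\<bar> \<le> \<bar>level n v\<bar>\<close>, all of them occur among the rises of the matching.\<close>

lemma trap_exists:
  assumes v: "v \<in> board n" and rl: "\<bar>rise v\<bar> \<le> \<bar>level n v\<bar>" and "rise v \<noteq> 0"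
    and "\<bar>rise v\<bar> = 1 \<Longrightarrow> v \<in> border n"
  shows "\<exists>T. traps n T v \<and> int (card T) = int n - 1 - \<bar>rise v\<bar>"
proof -
  define p q M where "p = rise v" and "q = level n v" and "M = int n - 1 - \<bar>rise v\<bar>"
  let ?S = "progression M q - {q}" and ?E = "progression M p - {p}"
  have pq: "0 < \<bar>p\<bar>" "\<bar>p\<bar> \<le> \<bar>q\<bar>" "\<bar>p\<bar> + \<bar>q\<bar> \<le> int n - 1"
    using assms by (auto simp: p_def q_def board_iff)
  have par: "even (p + q + (int n - 1))"
    using parity_rise_level[of v n] unfolding p_def q_def by presburger
  have parM: "even (M - q)"
    using par unfolding M_def p_def by presburger
  obtain m where m: "bij_betw m ?S ?E" "\<forall>s\<in>?S. \<bar>s\<bar> + \<bar>m s\<bar> \<le> int n - 1"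
    using matching_exists[OF pq par, of M] assms(4)
    by (auto simp: border_iff p_def q_def M_def)
  define T where "T = (\<lambda>s. cell_at n (m s) s) ` ?S"
  have at: "rise (cell_at n (m s) s) = m s" "level n (cell_at n (m s) s) = s" if "s \<in> ?S" for s
  proof -
    have "m s \<in> ?E"
      using m(1) that bij_betwE by blast
    then have "even (m s + s + int n + 1)"
      using that par by (simp add: progression_def)
    then show "rise (cell_at n (m s) s) = m s" "level n (cell_at n (m s) s) = s"
      by (simp_all add: rise_cell_at level_cell_at)
  qed
  have levelT: "level n ` T = ?S"
    unfolding T_def image_image using at(2) by simp
  have riseT: "rise ` T = ?E"
    using at(1) m(1) unfolding T_def image_image bij_betw_def by simp
  have injT: "inj_on (level n) T" "inj_on rise T"
    unfolding T_def using at m(1) by (auto simp: inj_on_def bij_betw_def)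
  then have cardT: "card T = card ?S"
    using card_image levelT by metis
  have vT: "v \<notin> T" "rise v \<notin> rise ` T" "level n v \<notin> level n ` T"
    using levelT riseT by (auto simp: q_def p_def)
  moreover have "inj_on rise (insert v T)" "inj_on (level n) (insert v T)"
    using injT vT by simp_all
  moreover have "T \<subseteq> board n"
    unfolding T_def
  proof (rule image_subsetI)
    fix s assume s: "s \<in> ?S"
    show "cell_at n (m s) s \<in> board n"
      using m(2) s unfolding board_iff at[OF s] by (simp add: add.commute)
  qed
  moreover have "level n c \<in> ?S" if c: "c \<in> board n" "c \<noteq> v" "rise c = rise v" for c
  proof -
    have "even (level n c - q)"
      using parity_rise_level[of v n] parity_rise_level[of c n] c(3) unfolding q_def by presburger
    moreover have "level n c \<noteq> q"
      using c cell_eq_iff[of c v n] by (simp add: q_def)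
    ultimately show ?thesis
      using c unfolding Diff_iff progression_symmetric[OF parM] by (simp add: board_iff M_def)
  qed
  moreover have "rise c \<in> ?E" if c: "c \<in> board n" "c \<noteq> v" "level n c = level n v" for c
  proof -
    have "even (rise c - p)"
      using parity_rise_level[of v n] parity_rise_level[of c n] c(3) unfolding p_def by presburger
    moreover have "rise c \<noteq> p"
      using c cell_eq_iff[of c v n] by (simp add: p_def)
    moreover have "- M \<le> rise c \<and> rise c \<le> M + 1"
      using c(1,3) rl unfolding board_iff M_def by linarith
    ultimately show ?thesis
      by (simp add: progression_def)
  qed
  ultimately have "traps n T v"
    unfolding traps_iff[OF v] levelT riseT by blast
  moreover have "int (card T) = M"
  proof -
    have "q \<in> progression M q"
      using pq unfolding progression_symmetric[OF parM] by (simp add: M_def p_def)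
    then have "card (progression M q) = Suc (card ?S)"
      by (intro card.remove) auto
    moreover have "int (card (progression M q)) = M + 1"
      using pq by (intro card_progression) (simp add: M_def p_def)
    ultimately show ?thesis
      using cardT by simp
  qed
  ultimately show ?thesis
    by (auto simp: M_def)
qed

lemma trapping_if_rise_le_level:
  assumes v: "v \<in> board n" and rl: "\<bar>rise v\<bar> \<le> \<bar>level n v\<bar>"
  shows "(n \<noteq> 1 \<and> (on_main_diagonal n v \<or> (on_adjacent_diagonal n v \<and> v \<notin> border n))
            \<longrightarrow> \<not> trappable n v) \<and>
         (\<not> (on_main_diagonal n v \<or> (on_adjacent_diagonal n v \<and> v \<notin> border n))
            \<longrightarrow> trappable n v \<and> min_bishops n v = longer_diagonal_length n v - 1)"
proof (intro conjI impI)
  assume "n \<noteq> 1 \<and> (on_main_diagonal n v \<or> (on_adjacent_diagonal n v \<and> v \<notin> border n))"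
  with rl show "\<not> trappable n v"
    unfolding on_main_diagonal_iff on_adjacent_diagonal_iff
    by (intro not_trappable[OF v]) auto
next
  assume "\<not> (on_main_diagonal n v \<or> (on_adjacent_diagonal n v \<and> v \<notin> border n))"
  then obtain T where T: "traps n T v" "int (card T) = int n - 1 - \<bar>rise v\<bar>"
    using trap_exists[OF v rl] unfolding on_main_diagonal_iff on_adjacent_diagonal_iff by auto
  then show "trappable n v"
    by (auto simp: trappable_def)
  have "min_bishops n v = card T"
    unfolding min_bishops_def
  proof (rule Least_equality)
    fix k assume "\<exists>T'. traps n T' v \<and> card T' = k"
    then show "card T \<le> k"
      using lower_bound[OF v] T(2) by fastforce
  qed (use T in blast)
  then show "min_bishops n v = longer_diagonal_length n v - 1"
    using longer_diagonal_length_eq[OF v] T(2) rl by simp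
qed

theorem mainTheorem8:
  fixes n :: nat and v :: cell
  assumes "v \<in> board n"
  shows "(n \<noteq> 1 \<and> (on_main_diagonal n v \<or> (on_adjacent_diagonal n v \<and> v \<notin> border n))
            \<longrightarrow> \<not> trappable n v) \<and>
         (\<not> (on_main_diagonal n v \<or> (on_adjacent_diagonal n v \<and> v \<notin> border n))
            \<longrightarrow> trappable n v \<and> min_bishops n v = longer_diagonal_length n v - 1)"
proof (cases "\<bar>rise v\<bar> \<le> \<bar>level n v\<bar>")
  case True
  with assms show ?thesis
    by (rule trapping_if_rise_le_level)
next
  case False
  have "int (longer_diagonal_length n (flip n v)) = int (longer_diagonal_length n v)"
    using assms by (simp add: longer_diagonal_length_eq min.commute)
  moreover have "on_main_diagonal n (flip n v) = on_main_diagonal n v"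
    "on_adjacent_diagonal n (flip n v) = on_adjacent_diagonal n v"
    by (auto simp: on_main_diagonal_iff on_adjacent_diagonal_iff)
  ultimately show ?thesis
    using trapping_if_rise_le_level[of "flip n v" n] False assms
    by (simp add: trappable_flip min_bishops_flip)
qed

end
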